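(* Let $0<a\le 1$, $b>0$, and let $(x,y)$ satisfy $0\le x\le \frac a2$, $0\le y\le \frac12$. Let $D(a,b,x,y)$ be the minimal length of a path, along the surface of the box $B=[-\frac a2,\frac a2]\times[-\frac12,\frac12]\times[0,b]$, from the point $(x,y,b)$ to its opposite point $(-x,-y,0)$ (the reflection of $(x,y,b)$ across the center of $B$). Then $$D(a,b,x,y)^2=\min\{d_{R,0},d_{R,1},d_{R,2},d_{U,0},d_{U,1},d_{U,2}\},$$ where the six functions are evaluated at $(a,b,x,y)$.
   Context: The six functions (squared lengths of six candidate paths, each a line segment on a planar flattening of the box) are: $d_{R,0}=4y^2+a^2+2ab+b^2$; $d_{R,1}=2x^2+4xy+2y^2-2bx-2by+\frac12a^2+(b+1)a+b^2+b+\frac12$; $d_{R,2}=4x^2-(4a+4b)x+2a^2+(2b+2)a+b^2+1$; $d_{U,0}=4x^2+b^2+2b+1$; $d_{U,1}=2x^2-4xy+2y^2+2bx-2by+\frac12a^2+(b+1)a+b^2+b+\frac12$; $d_{U,2}=4y^2-(4b+4)y+a^2+2a+b^2+2b+2$. *)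

theory Defs
  imports "HOL-Analysis.Analysis"
begin

text \<open>
  The length of a path is the supremum of the lengths of its inscribed polygonal lines
  (infinite for a non-rectifiable path).  A finite sequence of parameters
  \<open>t 0 \<le> \<dots> \<le> t n\<close> is represented by a monotone \<open>t :: nat \<Rightarrow> real\<close>, of which only the
  first \<open>n + 1\<close> values are used.
\<close>

definition path_length :: "(real \<Rightarrow> 'a::metric_space) \<Rightarrow> ennreal" where
  "path_length g =
    (SUP (n, t) \<in> {(n::nat, t::nat \<Rightarrow> real). mono t \<and> range t \<subseteq> {0..1}}.
      ennreal (\<Sum>i<n. dist (g (t i)) (g (t (Suc i)))))"

definition paths_within :: "'a::topological_space set \<Rightarrow> 'a \<Rightarrow> 'a \<Rightarrow> (real \<Rightarrow> 'a) set" where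
  "paths_within S p q =
    {g. path g \<and> path_image g \<subseteq> S \<and> pathstart g = p \<and> pathfinish g = q}"

definition intrinsic_dist :: "'a::metric_space set \<Rightarrow> 'a \<Rightarrow> 'a \<Rightarrow> ennreal" where
  "intrinsic_dist S p q = (INF g \<in> paths_within S p q. path_length g)"

text \<open>
  Three-dimensional space is \<open>real \<times> real \<times> real\<close>, whose library metric is the Euclidean one.
\<close>

definition box_solid :: "real \<Rightarrow> real \<Rightarrow> (real \<times> real \<times> real) set" where
  "box_solid a b = {- a/2..a/2} \<times> {- 1/2..1/2} \<times> {0..b}"

definition box_surface :: "real \<Rightarrow> real \<Rightarrow> (real \<times> real \<times> real) set" where
  "box_surface a b = frontier (box_solid a b)"

definition opposite_paths ::
  "real \<Rightarrow> real \<Rightarrow> real \<Rightarrow> real \<Rightarrow> (real \<Rightarrow> real \<times> real \<times> real) set" where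
  "opposite_paths a b x y = paths_within (box_surface a b) (x, y, b) (- x, - y, 0)"

definition opposite_dist :: "real \<Rightarrow> real \<Rightarrow> real \<Rightarrow> real \<Rightarrow> real" where
  "opposite_dist a b x y =
    enn2real (intrinsic_dist (box_surface a b) (x, y, b) (- x, - y, 0))"

definition dR0 :: "real \<Rightarrow> real \<Rightarrow> real \<Rightarrow> real \<Rightarrow> real" where
  "dR0 a b x y = 4 * y\<^sup>2 + a\<^sup>2 + 2 * a * b + b\<^sup>2"

definition dR1 :: "real \<Rightarrow> real \<Rightarrow> real \<Rightarrow> real \<Rightarrow> real" where
  "dR1 a b x y = 2 * x\<^sup>2 + 4 * x * y + 2 * y\<^sup>2 - 2 * b * x - 2 * b * y
     + 1/2 * a\<^sup>2 + (b + 1) * a + b\<^sup>2 + b + 1/2"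

definition dR2 :: "real \<Rightarrow> real \<Rightarrow> real \<Rightarrow> real \<Rightarrow> real" where
  "dR2 a b x y = 4 * x\<^sup>2 - (4 * a + 4 * b) * x + 2 * a\<^sup>2 + (2 * b + 2) * a + b\<^sup>2 + 1"

definition dU0 :: "real \<Rightarrow> real \<Rightarrow> real \<Rightarrow> real \<Rightarrow> real" where
  "dU0 a b x y = 4 * x\<^sup>2 + b\<^sup>2 + 2 * b + 1"

definition dU1 :: "real \<Rightarrow> real \<Rightarrow> real \<Rightarrow> real \<Rightarrow> real" where
  "dU1 a b x y = 2 * x\<^sup>2 - 4 * x * y + 2 * y\<^sup>2 + 2 * b * x - 2 * b * y
     + 1/2 * a\<^sup>2 + (b + 1) * a + b\<^sup>2 + b + 1/2"

definition dU2 :: "real \<Rightarrow> real \<Rightarrow> real \<Rightarrow> real \<Rightarrow> real" where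
  "dU2 a b x y = 4 * y\<^sup>2 - (4 * b + 4) * y + a\<^sup>2 + 2 * a + b\<^sup>2 + 2 * b + 2"

end

theory Submission
  imports Defs
begin

text \<open>
  Lower bound.  A path along the surface can be shortened to a polygon: cut it at the last time
  on the top and at the first later time on the bottom, and in between replace its stay on each
  side face, from the first to the last visit, by the chord (\<open>path_chain\<close>).  The polygon so
  obtained runs over the top, then over one to four distinct side faces, consecutive ones sharing
  a vertical edge, then over the bottom.  Unfolding these faces into a plane turns it into a
  polygon whose end points depend only on the sequence of faces, so its length is at least the
  distance of these two points.  There are \<open>28\<close> sequences; up to the symmetries of the box there
  are four, namely those that start on the side facing \<open>+x\<close> and turn towards \<open>+y\<close>
  (\<open>no_corner\<close>, \<open>one_corner\<close>, \<open>two_corners\<close>, \<open>three_corners\<close>).  Symmetric images of a problem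
  exchange or reflect the two coordinates, and therefore everything is done for a box with
  arbitrary half sides \<open>h\<close> and \<open>k\<close> and, here, with signed \<open>x\<close> and \<open>y\<close>.  The \<open>28\<close> sequences yield
  \<open>14\<close> distances (\<open>below_images\<close>), six of which are the candidates of the theorem.  The other
  eight never beat all candidates (\<open>below_candidates_imp_below_images\<close>); only one of them, the
  two-sided unfolding with \<open>x - y\<close> in place of \<open>x + y\<close>, needs \<open>a \<le> 1\<close> for this.

  Upper bound.  Each candidate is the squared length of a segment in an unfolding, but this
  segment may leave the unfolded faces, so that it is not the image of a path on the box.  This
  happens only when it passes a corner of the box on the wrong side.  Then a quarter turn of the
  top or of the bottom about that corner attaches it to the next side face and brings the two end
  points closer together, because the quarter turn closes the gap between the unfolded faces.  The
  result is an unfolding with one side face fewer.  Hence, by descent on the number of side faces,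
  every candidate is at least the squared length of an actual path
  (\<open>over_two_sides\<close>, \<open>over_three_sides\<close>, \<open>candidates_reached\<close>).  Applied to the least
  candidate, both bounds together show that this path is a shortest one.
\<close>

section \<open>Lengths of inscribed polygons\<close>

definition inscribed :: "(real \<Rightarrow> 'a::metric_space) \<Rightarrow> real \<Rightarrow> real \<Rightarrow> real \<Rightarrow> bool" where
  "inscribed g s t l \<longleftrightarrow> (\<exists>n \<tau>. mono \<tau> \<and> range \<tau> \<subseteq> {s..t} \<and> \<tau> 0 = s \<and>
     l = (\<Sum>i<n. dist (g (\<tau> i)) (g (\<tau> (Suc i)))))"

lemma inscribed_refl: "inscribed g t t 0"
  unfolding inscribed_def
  by (rule exI[of _ 0], rule exI[of _ "\<lambda>_. t"]) (auto simp: mono_def)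

lemma inscribed_Cons:
  assumes "s \<le> u" "u \<le> t" "inscribed g u t l"
  shows "inscribed g s t (dist (g s) (g u) + l)"
proof -
  obtain n \<tau> where \<tau>: "mono \<tau>" "range \<tau> \<subseteq> {u..t}" "\<tau> 0 = u"
    and l: "l = (\<Sum>i<n. dist (g (\<tau> i)) (g (\<tau> (Suc i))))"
    using assms(3) unfolding inscribed_def by blast
  define \<tau>' where "\<tau>' = case_nat s \<tau>"
  have ge: "u \<le> \<tau> i" "\<tau> i \<le> t" for i
    using \<tau>(2) by (auto simp: image_subset_iff)
  have "mono \<tau>'"
    unfolding mono_iff_le_Suc
  proof
    fix i show "\<tau>' i \<le> \<tau>' (Suc i)"
      using \<tau>(1) \<tau>(3) assms(1) by (cases i) (auto simp: \<tau>'_def mono_iff_le_Suc)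
  qed
  moreover have "range \<tau>' \<subseteq> {s..t}"
  proof -
    have "s \<le> \<tau>' i \<and> \<tau>' i \<le> t" for i
      using ge assms(1,2) by (cases i) (auto simp: \<tau>'_def intro: order_trans)
    then show ?thesis by auto
  qed
  moreover have "\<tau>' 0 = s" by (simp add: \<tau>'_def)
  moreover have "dist (g s) (g u) + l = (\<Sum>i<Suc n. dist (g (\<tau>' i)) (g (\<tau>' (Suc i))))"
    by (subst sum.lessThan_Suc_shift) (simp add: \<tau>'_def l \<tau>(3))
  ultimately show ?thesis unfolding inscribed_def by blast
qed

lemma inscribed_le_path_length:
  assumes "inscribed g 0 1 l"
  shows "ennreal l \<le> path_length g"
proof -
  obtain n \<tau> where "mono \<tau>" "range \<tau> \<subseteq> {0..1}"
    and "l = (\<Sum>i<n. dist (g (\<tau> i)) (g (\<tau> (Suc i))))"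
    using assms unfolding inscribed_def by blast
  then show ?thesis
    unfolding path_length_def by (intro SUP_upper2[of "(n, \<tau>)"]) auto
qed

text \<open>
  The reduction of a path to finitely many segments: between the first and the last time in a
  convex piece, the path is no shorter than the chord, and after the last time that piece can be
  struck off the list.
\<close>

inductive chain :: "'a::metric_space set set \<Rightarrow> 'a \<Rightarrow> 'a \<Rightarrow> real \<Rightarrow> bool" where
  last: "F \<in> \<F> \<Longrightarrow> p \<in> F \<Longrightarrow> q \<in> F \<Longrightarrow> chain \<F> p q (dist p q)"
| step: "F \<in> \<F> \<Longrightarrow> p \<in> F \<Longrightarrow> r \<in> F \<Longrightarrow> chain (\<F> - {F}) r q l \<Longrightarrow> chain \<F> p q (dist p r + l)"

lemma chain_mono: "chain \<F> p q l \<Longrightarrow> \<F> \<subseteq> \<G> \<Longrightarrow> chain \<G> p q l"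
proof (induction arbitrary: \<G> rule: chain.induct)
  case (last F \<F> p q)
  then show ?case by (blast intro: chain.last)
next
  case (step F \<F> p r q l)
  have "\<F> - {F} \<subseteq> \<G> - {F}" using step.prems by blast
  then show ?case using step by (blast intro: chain.step)
qed

lemma chain_image:
  assumes iso: "\<And>u v. dist (\<phi> u) (\<phi> v) = dist u v"
  shows "chain \<F> p q l \<Longrightarrow> chain ((`) \<phi> ` \<F>) (\<phi> p) (\<phi> q) l"
proof (induction rule: chain.induct)
  case (last F \<F> p q)
  have "chain ((`) \<phi> ` \<F>) (\<phi> p) (\<phi> q) (dist (\<phi> p) (\<phi> q))"
    by (rule chain.last[of "\<phi> ` F"]) (use last in auto)
  then show ?case by (simp add: iso)
next
  case (step F \<F> p r q l)
  have "inj \<phi>" by (rule injI) (metis iso dist_eq_0_iff)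
  then have "inj ((`) \<phi>)" by (simp add: inj_on_def inj_image_eq_iff)
  then have eq: "(`) \<phi> ` (\<F> - {F}) = (`) \<phi> ` \<F> - {\<phi> ` F}"
    by (simp add: image_set_diff)
  have "chain ((`) \<phi> ` \<F>) (\<phi> p) (\<phi> q) (dist (\<phi> p) (\<phi> r) + l)"
    by (rule chain.step[of "\<phi> ` F"]) (use step eq in auto)
  then show ?case by (simp add: iso)
qed

lemma chain_cases:
  assumes "chain \<F> p q l"
  obtains F where "F \<in> \<F>" "p \<in> F" "q \<in> F" "l = dist p q"
  | F r l' where "F \<in> \<F>" "p \<in> F" "r \<in> F" "l = dist p r + l'" "chain (\<F> - {F}) r q l'"
  using assms by (cases rule: chain.cases) auto

text \<open>
  A chain split into its first leg, on the piece \<open>F\<close>, and the rest, on pieces from \<open>\<G>\<close>.  Recording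
  \<open>F\<close> and \<open>\<G>\<close> separately makes it possible to treat the case that the chain ends on \<open>F\<close> together
  with the case that it goes on, and to weaken \<open>\<G>\<close> to an explicit list of faces.
\<close>

definition run :: "'a::metric_space set \<Rightarrow> 'a set set \<Rightarrow> 'a \<Rightarrow> 'a \<Rightarrow> real \<Rightarrow> bool" where
  "run F \<G> p q l \<longleftrightarrow> p \<in> F \<and> (q \<in> F \<and> l = dist p q \<or>
     (\<exists>r l'. r \<in> F \<and> l = dist p r + l' \<and> chain \<G> r q l'))"

lemma chain_run: "chain \<F> p q l \<Longrightarrow> \<exists>F \<in> \<F>. run F (\<F> - {F}) p q l"
  unfolding run_def by (erule chain_cases) blast+

lemma run_mono: "run F \<F> p q l \<Longrightarrow> \<F> \<subseteq> \<G> \<Longrightarrow> run F \<G> p q l"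
  unfolding run_def by (blast intro: chain_mono)

lemma run_image:
  assumes iso: "\<And>u v. dist (\<phi> u) (\<phi> v) = dist u v" and "run F \<G> p q l"
  shows "run (\<phi> ` F) ((`) \<phi> ` \<G>) (\<phi> p) (\<phi> q) l"
proof -
  have p: "\<phi> p \<in> \<phi> ` F" using assms(2) by (simp add: run_def)
  from assms(2) consider "q \<in> F" "l = dist p q"
    | r l' where "r \<in> F" "l = dist p r + l'" "chain \<G> r q l'"
    unfolding run_def by blast
  then show ?thesis
  proof cases
    case 1
    then show ?thesis using p by (simp add: run_def iso)
  next
    case 2
    have "chain ((`) \<phi> ` \<G>) (\<phi> r) (\<phi> q) l'" using chain_image[of \<phi>, OF iso 2(3)] .
    moreover have "l = dist (\<phi> p) (\<phi> r) + l'" "\<phi> r \<in> \<phi> ` F" using 2 by (simp_all add: iso)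
    ultimately show ?thesis using p unfolding run_def by blast
  qed
qed

text \<open>
  The next piece exists because the times after the last visit to \<open>F\<close> lie in the preimage of the
  remaining pieces; that preimage is closed, so it contains the last visit itself.  The polygon
  length \<open>l\<^sub>0\<close> beyond time \<open>t\<close> is carried along, since \<open>inscribed\<close> polygons are extended only at their
  beginning.
\<close>

lemma path_chain:
  fixes g :: "real \<Rightarrow> 'a::metric_space"
  assumes "finite \<F>" "\<And>F. F \<in> \<F> \<Longrightarrow> closed F" "s \<le> t" "t \<le> 1"
    and "continuous_on {s..t} g" "g ` {s..t} \<subseteq> \<Union>\<F>" "inscribed g t 1 l\<^sub>0"
  shows "\<exists>l. chain \<F> (g s) (g t) l \<and> inscribed g s 1 (l + l\<^sub>0)"
  using assms
proof (induction "card \<F>" arbitrary: \<F> s rule: less_induct)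
  case less
  have "g s \<in> \<Union>\<F>" 
    using less.prems(3) by (intro subsetD[OF less.prems(6)] imageI) simp
  then obtain F where F: "F \<in> \<F>" "g s \<in> F" by blast
  define T where "T = {s..t} \<inter> g -` F"
  have "closed T"
    unfolding T_def using less.prems F by (intro continuous_closed_preimage) auto
  then have "compact T"
    using compact_Int_closed[of "{s..t}" T] by (simp add: T_def Int_assoc[symmetric])
  moreover have "s \<in> T" using F less.prems by (simp add: T_def)
  ultimately obtain u where u: "u \<in> T" "\<And>v. v \<in> T \<Longrightarrow> v \<le> u"
    using compact_attains_sup[of T] by blast
  then have su: "s \<le> u" "u \<le> t" "g u \<in> F" by (auto simp: T_def)
  show ?case
  proof (cases "u = t")
    case True
    then have "chain \<F> (g s) (g t) (dist (g s) (g t))"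
      using F su by (blast intro: chain.last)
    moreover have "inscribed g s 1 (dist (g s) (g t) + l\<^sub>0)"
      using less.prems by (intro inscribed_Cons) auto
    ultimately show ?thesis by blast
  next
    case False
    then have ut: "u < t" using su by simp
    define C where "C = {s..t} \<inter> g -` \<Union>(\<F> - {F})"
    have "closed C"
      unfolding C_def using less.prems by (intro continuous_closed_preimage closed_Union) auto
    have "{u<..t} \<subseteq> C"
    proof
      fix v assume v: "v \<in> {u<..t}"
      then have "v \<notin> T" using u(2)[of v] by auto
      then have "g v \<notin> F" using v su by (auto simp: T_def)
      moreover have "g v \<in> \<Union>\<F>" 
        using v su by (intro subsetD[OF less.prems(6)] imageI) simp
      ultimately show "v \<in> C" using v su by (auto simp: C_def)
    qed
    then have "closure {u<..t} \<subseteq> C"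
      using \<open>closed C\<close> by (simp add: closure_minimal)
    then have C: "{u..t} \<subseteq> C"
      using ut by simp
    have "card (\<F> - {F}) < card \<F>"
      using F less.prems(1) by (intro card_Diff1_less)
    then have "\<exists>l. chain (\<F> - {F}) (g u) (g t) l \<and> inscribed g u 1 (l + l\<^sub>0)"
    proof (rule less.hyps)
      show "continuous_on {u..t} g"
        using less.prems(5) su by (auto intro: continuous_on_subset)
      show "g ` {u..t} \<subseteq> \<Union>(\<F> - {F})" using C by (auto simp: C_def)
    qed (use less.prems su in auto)
    then obtain l where l: "chain (\<F> - {F}) (g u) (g t) l" "inscribed g u 1 (l + l\<^sub>0)" by blast
    have "chain \<F> (g s) (g t) (dist (g s) (g u) + l)"
      using F su l by (blast intro: chain.step)
    moreover have "inscribed g s 1 (dist (g s) (g u) + (l + l\<^sub>0))"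
      using su less.prems l by (intro inscribed_Cons) auto
    ultimately show ?thesis by (metis add.assoc)
  qed
qed

section \<open>Curves of bounded speed\<close>

text \<open>
  Reachability at speed at most one in time \<open>l\<close>.  In this form segments can be concatenated
  without computing the length of a joined path, and only an upper bound on the length is needed.
\<close>

definition reach :: "'a::metric_space set \<Rightarrow> 'a \<Rightarrow> 'a \<Rightarrow> real \<Rightarrow> bool" where
  "reach S p q l \<longleftrightarrow> 0 \<le> l \<and> (\<exists>g. g 0 = p \<and> g l = q \<and> g ` {0..l} \<subseteq> S \<and>
     (\<forall>s t. 0 \<le> s \<and> s \<le> t \<and> t \<le> l \<longrightarrow> dist (g s) (g t) \<le> t - s))"

lemma reach_segment:
  fixes p q :: "'a::real_normed_vector"
  assumes "convex F" "F \<subseteq> S" "p \<in> F" "q \<in> F"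
  shows "reach S p q (dist p q)"
proof (cases "p = q")
  case True
  then show ?thesis using assms unfolding reach_def by (auto intro!: exI[of _ "\<lambda>_. p"])
next
  case False
  let ?l = "dist p q"
  have l: "?l > 0" using False by simp
  let ?g = "\<lambda>t. linepath p q (t / ?l)"
  have "?g ` {0..?l} \<subseteq> S"
  proof
    fix u assume "u \<in> ?g ` {0..?l}"
    then obtain t where t: "0 \<le> t" "t \<le> ?l" "u = ?g t" by auto
    then have "0 \<le> t / ?l" "t / ?l \<le> 1" using l by (auto simp: divide_simps)
    then have "u \<in> closed_segment p q"
      unfolding t(3) by (auto simp: linepath_in_path)
    also have "\<dots> \<subseteq> F" using assms by (simp add: closed_segment_subset)
    finally show "u \<in> S" using assms by blast
  qed
  moreover have "dist (?g s) (?g t) \<le> t - s" if "s \<le> t" for s t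
  proof -
    have "?g s - ?g t = ((t - s) / ?l) *\<^sub>R (p - q)"
      by (simp add: linepath_def algebra_simps diff_divide_distrib)
    then have "dist (?g s) (?g t) = \<bar>(t - s) / ?l\<bar> * ?l"
      by (simp add: dist_norm)
    then show ?thesis using that l by simp
  qed
  ultimately show ?thesis
    unfolding reach_def using l by (auto intro!: exI[of _ ?g] simp: linepath_def)
qed

lemma reach_trans:
  assumes "reach S p q l" "reach S q r m"
  shows "reach S p r (l + m)"
proof -
  obtain f where f: "0 \<le> l" "f 0 = p" "f l = q" "f ` {0..l} \<subseteq> S"
    "\<And>s t. 0 \<le> s \<Longrightarrow> s \<le> t \<Longrightarrow> t \<le> l \<Longrightarrow> dist (f s) (f t) \<le> t - s"
    using assms(1) unfolding reach_def by blast
  obtain g where g: "0 \<le> m" "g 0 = q" "g m = r" "g ` {0..m} \<subseteq> S"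
    "\<And>s t. 0 \<le> s \<Longrightarrow> s \<le> t \<Longrightarrow> t \<le> m \<Longrightarrow> dist (g s) (g t) \<le> t - s"
    using assms(2) unfolding reach_def by blast
  define h where "h = (\<lambda>t. if t \<le> l then f t else g (t - l))"
  have "h 0 = p" using f by (simp add: h_def)
  moreover have "h (l + m) = r" using f g by (auto simp: h_def)
  moreover have "h ` {0..l+m} \<subseteq> S" using f(4) g(4) by (auto simp: h_def image_subset_iff)
  moreover have "dist (h s) (h t) \<le> t - s" if st: "0 \<le> s" "s \<le> t" "t \<le> l + m" for s t
  proof -
    consider "t \<le> l" | "s \<le> l" "l < t" | "l < s" by linarith
    then show ?thesis
    proof cases
      case 1 then show ?thesis using st f(5) by (simp add: h_def)
    next
      case 2
      have "dist (f s) (g (t - l)) \<le> dist (f s) q + dist q (g (t - l))" by (rule dist_triangle)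
      also have "\<dots> \<le> (l - s) + (t - l)"
        using f(5)[of s l] g(5)[of 0 "t - l"] f(3) g(2) st 2 by (intro add_mono) auto
      finally show ?thesis using 2 by (simp add: h_def)
    next
      case 3
      then show ?thesis using st g(5)[of "s - l" "t - l"] by (simp add: h_def)
    qed
  qed
  ultimately show ?thesis using f(1) g(1) unfolding reach_def by (intro conjI exI[of _ h]) auto
qed

lemma reach_image:
  assumes iso: "\<And>u v. dist (\<phi> u) (\<phi> v) = dist u v" and "reach S p q l"
  shows "reach (\<phi> ` S) (\<phi> p) (\<phi> q) l"
proof -
  obtain f where f: "0 \<le> l" "f 0 = p" "f l = q" "f ` {0..l} \<subseteq> S"
    "\<And>s t. 0 \<le> s \<Longrightarrow> s \<le> t \<Longrightarrow> t \<le> l \<Longrightarrow> dist (f s) (f t) \<le> t - s"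
    using assms(2) unfolding reach_def by blast
  show ?thesis
    unfolding reach_def using f by (intro conjI exI[of _ "\<phi> \<circ> f"]) (auto simp: iso)
qed

lemma reach_path:
  assumes "reach S p q l"
  shows "\<exists>g \<in> paths_within S p q. path_length g \<le> ennreal l"
proof -
  obtain f where f: "0 \<le> l" "f 0 = p" "f l = q" "f ` {0..l} \<subseteq> S"
    "\<And>s t. 0 \<le> s \<Longrightarrow> s \<le> t \<Longrightarrow> t \<le> l \<Longrightarrow> dist (f s) (f t) \<le> t - s"
    using assms unfolding reach_def by blast
  define g where "g = (\<lambda>t. f (l * t))"
  have lip: "dist (g s) (g t) \<le> l * (t - s)" if "0 \<le> s" "s \<le> t" "t \<le> 1" for s t
    using f(5)[of "l * s" "l * t"] that f(1) unfolding g_def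
    by (simp add: mult_left_mono mult_left_le right_diff_distrib)
  have "l-lipschitz_on {0..1} g"
  proof (rule lipschitz_onI)
    fix s t :: real assume "s \<in> {0..1}" "t \<in> {0..1}"
    then show "dist (g s) (g t) \<le> l * dist s t"
      using lip[of s t] lip[of t s] by (cases "s \<le> t") (auto simp: dist_real_def dist_commute)
  qed (fact f(1))
  then have "path g" unfolding path_def by (rule lipschitz_on_continuous_on)
  moreover have "path_image g \<subseteq> S"
    using f(1,4) by (auto simp: path_image_def g_def image_subset_iff mult_left_le)
  ultimately have "g \<in> paths_within S p q"
    using f by (simp add: paths_within_def pathstart_def pathfinish_def g_def)
  moreover have "path_length g \<le> ennreal l"
    unfolding path_length_def
  proof (rule SUP_least, clarify)
    fix n :: nat and \<tau> :: "nat \<Rightarrow> real"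
    assume \<tau>: "mono \<tau>" "range \<tau> \<subseteq> {0..1}"
    have r: "0 \<le> \<tau> i" "\<tau> i \<le> 1" for i using \<tau>(2) by (auto simp: image_subset_iff)
    have "(\<Sum>i<n. dist (g (\<tau> i)) (g (\<tau> (Suc i)))) \<le> (\<Sum>i<n. l * (\<tau> (Suc i) - \<tau> i))"
      using r \<tau>(1) by (intro sum_mono lip) (auto simp: mono_iff_le_Suc)
    also have "\<dots> = l * (\<tau> n - \<tau> 0)"
      by (simp add: sum_distrib_left[symmetric] sum_lessThan_telescope)
    also have "\<dots> \<le> l * 1" using r[of n] r[of 0] f(1) by (intro mult_left_mono) auto
    finally show "ennreal (\<Sum>i<n. dist (g (\<tau> i)) (g (\<tau> (Suc i)))) \<le> ennreal l"
      by (simp add: ennreal_leI)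
  qed
  ultimately show ?thesis by blast
qed

section \<open>The box and its symmetries\<close>

text \<open>
  The box has half sides \<open>h\<close> and \<open>k\<close>; a negative \<open>c\<close> gives the opposite side face.
\<close>

definition side_x :: "real \<Rightarrow> real \<Rightarrow> real \<Rightarrow> (real \<times> real \<times> real) set" where
  "side_x c k b = {c} \<times> {-k..k} \<times> {0..b}"

definition side_y :: "real \<Rightarrow> real \<Rightarrow> real \<Rightarrow> (real \<times> real \<times> real) set" where
  "side_y h c b = {-h..h} \<times> {c} \<times> {0..b}"

definition lid :: "real \<Rightarrow> real \<Rightarrow> real \<Rightarrow> (real \<times> real \<times> real) set" where
  "lid h k c = {-h..h} \<times> {-k..k} \<times> {c}"

definition sides :: "real \<Rightarrow> real \<Rightarrow> real \<Rightarrow> (real \<times> real \<times> real) set set" where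
  "sides h k b = {side_x h k b, side_x (-h) k b, side_y h k b, side_y h (-k) b}"

definition shell :: "real \<Rightarrow> real \<Rightarrow> real \<Rightarrow> (real \<times> real \<times> real) set" where
  "shell h k b = lid h k b \<union> lid h k 0 \<union> \<Union>(sides h k b)"

lemmas face_defs = side_x_def side_y_def lid_def

lemma box_surface_eq:
  assumes "0 < a" "0 < b"
  shows "box_surface a b = shell (a/2) (1/2) b"
proof -
  have "closed (box_solid a b)"
    unfolding box_solid_def by (intro closed_Times closed_atLeastAtMost)
  then have "box_surface a b = box_solid a b - interior (box_solid a b)"
    by (simp add: box_surface_def frontier_def)
  also have "\<dots> = shell (a/2) (1/2) b"
    using assms unfolding box_solid_def shell_def sides_def face_defs interior_Times
    by (auto simp: )
  finally show ?thesis .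
qed

lemma dist2: "dist (x, y) (x', y') = sqrt ((x - x')\<^sup>2 + (y - y')\<^sup>2)"
  for x y x' y' :: real
  by (simp add: dist_Pair_Pair dist_real_def)

lemma dist3: "dist (x, y, z) (x', y', z') = sqrt ((x - x')\<^sup>2 + (y - y')\<^sup>2 + (z - z')\<^sup>2)"
  for x y z x' y' z' :: real
  by (simp add: dist_Pair_Pair dist_real_def)

definition flip_y :: "real \<times> real \<times> real \<Rightarrow> real \<times> real \<times> real" where
  "flip_y = (\<lambda>(x, y, z). (x, - y, z))"

definition swap_xy :: "real \<times> real \<times> real \<Rightarrow> real \<times> real \<times> real" where
  "swap_xy = (\<lambda>(x, y, z). (y, x, z))"

lemma flip_y_simps [simp]: "flip_y (x, y, z) = (x, - y, z)" by (simp add: flip_y_def)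
lemma swap_xy_simps [simp]: "swap_xy (x, y, z) = (y, x, z)" by (simp add: swap_xy_def)

lemma dist_flip_y: "dist (flip_y u) (flip_y v) = dist u v"
  by (cases u; cases v) (simp add: dist3 power2_eq_square algebra_simps)

lemma dist_swap_xy: "dist (swap_xy u) (swap_xy v) = dist u v"
  by (cases u; cases v) (simp add: dist3 add.commute)

lemma flip_y_flip_y: "flip_y (flip_y u) = u" by (cases u) simp
lemma swap_xy_swap_xy: "swap_xy (swap_xy u) = u" by (cases u) simp

lemma image_flip_y_eq: "flip_y ` A = {u. flip_y u \<in> A}"
proof (intro set_eqI iffI)
  fix u assume "u \<in> {u. flip_y u \<in> A}"
  then show "u \<in> flip_y ` A"
    using imageI[of "flip_y u" A flip_y] by (simp add: flip_y_flip_y)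
qed (auto simp: flip_y_flip_y)

lemma image_swap_xy_eq: "swap_xy ` A = {u. swap_xy u \<in> A}"
proof (intro set_eqI iffI)
  fix u assume "u \<in> {u. swap_xy u \<in> A}"
  then show "u \<in> swap_xy ` A"
    using imageI[of "swap_xy u" A swap_xy] by (simp add: swap_xy_swap_xy)
qed (auto simp: swap_xy_swap_xy)

lemma image_flip_y:
  "flip_y ` side_x c k b = side_x c k b" "flip_y ` side_y h c b = side_y h (- c) b"
  "flip_y ` lid h k c = lid h k c"
  unfolding image_flip_y_eq face_defs by auto

lemma image_swap_xy:
  "swap_xy ` side_x c k b = side_y k c b" "swap_xy ` side_y h c b = side_x c h b"
  "swap_xy ` lid h k c = lid k h c"
  unfolding image_swap_xy_eq face_defs by auto

lemma sides_flip_y: "(`) flip_y ` sides h k b = sides h k b"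
  unfolding sides_def by (simp add: image_flip_y) blast

lemma sides_swap_xy: "(`) swap_xy ` sides h k b = sides k h b"
  unfolding sides_def by (simp add: image_swap_xy) blast

lemma shell_flip_y: "flip_y ` shell h k b = shell h k b"
  unfolding shell_def by (simp only: image_Un image_Union sides_flip_y image_flip_y)

lemma shell_swap_xy: "swap_xy ` shell h k b = shell k h b"
  unfolding shell_def by (simp only: image_Un image_Union sides_swap_xy image_swap_xy)

section \<open>The lower bound: unfolding along every sequence of sides\<close>

text \<open>
  The length \<open>m\<close> is at most the distance between the unfolded end points, for every sequence of side
  faces: first for one side, then for two (and four) sides, where \<open>w\<close> runs through the sign choices
  of the starting side and of the turning direction, then for three sides.
\<close>

definition below_images :: "real \<Rightarrow> real \<Rightarrow> real \<Rightarrow> real \<Rightarrow> real \<Rightarrow> real \<Rightarrow> bool" where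
  "below_images m h k b x y \<longleftrightarrow>
     m\<^sup>2 \<le> (2*y)\<^sup>2 + (2*h + b)\<^sup>2 \<and> m\<^sup>2 \<le> (2*x)\<^sup>2 + (2*k + b)\<^sup>2 \<and>
     (\<forall>w \<in> {x + y, x - y, y - x, - x - y}.
        m\<^sup>2 \<le> (h + k + w)\<^sup>2 + (b + h + k - w)\<^sup>2 \<and>
        m\<^sup>2 \<le> (3*(h + k) - w)\<^sup>2 + (b + h + k - w)\<^sup>2) \<and>
     (\<forall>u \<in> {x, - x}. m\<^sup>2 \<le> (2*(h + k))\<^sup>2 + (b + 2*h - 2*u)\<^sup>2) \<and>
     (\<forall>v \<in> {y, - y}. m\<^sup>2 \<le> (2*(h + k))\<^sup>2 + (b + 2*k - 2 * v)\<^sup>2)"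

lemma below_images_flip_y: "below_images m h k b x y \<Longrightarrow> below_images m h k b x (- y)"
  unfolding below_images_def by (simp add: add_ac minus_diff_commute)

lemma below_images_swap_xy: "below_images m h k b x y \<Longrightarrow> below_images m k h b y x"
  unfolding below_images_def by (simp add: add_ac minus_diff_commute)

lemma polyline3: "dist A D \<le> dist A B + dist B C + dist C D"
  for A B C D :: "'a::metric_space"
  using dist_triangle[of A D B] dist_triangle[of B D C] by simp

lemma polyline4: "dist A E \<le> dist A B + dist B C + dist C D + dist D E"
  for A B C D E :: "'a::metric_space"
  using polyline3[of A D B C] dist_triangle[of A E D] by simp

lemma polyline5: "dist A F \<le> dist A B + dist B C + dist C D + dist D E + dist E F"
  for A B C D E F :: "'a::metric_space"
  using polyline4[of A E B C D] dist_triangle[of A F E] by simp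

lemma polyline6: "dist A G \<le> dist A B + dist B C + dist C D + dist D E + dist E F + dist F G"
  for A B C D E F G :: "'a::metric_space"
  using polyline5[of A F B C D E] dist_triangle[of A G F] by simp

text \<open>
  In the following four lemmas the side faces are laid out in a strip, with the horizontal
  coordinate running along the perimeter from \<open>y\<close> on the side facing \<open>+x\<close>, and with the height as
  vertical coordinate.  The top is attached above the first side face and the bottom below the last
  one.  Each segment of the polygon lies in one face and keeps its length under the unfolding.
\<close>

lemma no_corner:
  assumes m: "below_images m h k b x y" and e: "(ex, ey, b) \<in> side_x h k b"
    and f: "(fx, fy, 0) \<in> side_x h k b"
  shows "m \<le> dist (x, y, b) (ex, ey, b) + (dist (ex, ey, b) (fx, fy, 0))
    + dist (fx, fy, 0) (- x, - y, 0::real)"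
proof -
  have ef: "ex = h" "fx = h" using e f by (auto simp: face_defs)
  note zs = ef
  have "m \<le> dist (y, b + h - x) (- y, - (h + x))"
    using m unfolding below_images_def dist2
    by (intro real_le_rsqrt) (simp add: power2_eq_square algebra_simps)
  also have "\<dots> \<le> dist (y, b + h - x) (ey, b) + dist (ey, b) (fy, 0) + dist (fy, 0) (- y, - (h + x))"
    by (rule polyline3)
  also have "dist (y, b + h - x) (ey, b) = dist (x, y, b) (ex, ey, b)"
    by (simp add: zs dist2 dist3 power2_eq_square algebra_simps)
  also have "dist (ey, b) (fy, 0) = dist (ex, ey, b) (fx, fy, 0)"
    by (simp add: zs dist2 dist3 power2_eq_square algebra_simps)
  also have "dist (fy, 0) (- y, - (h + x)) = dist (fx, fy, 0) (- x, - y, 0::real)"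
    by (simp add: zs dist2 dist3 power2_eq_square algebra_simps)
  finally show ?thesis by simp
qed

lemma one_corner:
  assumes m: "below_images m h k b x y" and e: "(ex, ey, b) \<in> side_x h k b"
    and r: "r \<in> side_x h k b" "r \<in> side_y h k b"
    and f: "(fx, fy, 0) \<in> side_y h k b"
  shows "m \<le> dist (x, y, b) (ex, ey, b) + (dist (ex, ey, b) r + (dist r (fx, fy, 0)))
    + dist (fx, fy, 0) (- x, - y, 0::real)"
proof -
  obtain z0 where z0: "r = (h, k, z0)" using r by (auto simp: face_defs)
  have ef: "ex = h" "fy = k" using e f by (auto simp: face_defs)
  note zs = ef z0
  have "m \<le> dist (y, b + h - x) (k + h + x, - (k + y))"
    using m unfolding below_images_def dist2
    by (intro real_le_rsqrt) (simp add: power2_eq_square algebra_simps)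
  also have "\<dots> \<le> dist (y, b + h - x) (ey, b) + dist (ey, b) (k, z0) + dist (k, z0) (k + h - fx, 0) + dist (k + h - fx, 0) (k + h + x, - (k + y))"
    by (rule polyline4)
  also have "dist (y, b + h - x) (ey, b) = dist (x, y, b) (ex, ey, b)"
    by (simp add: zs dist2 dist3 power2_eq_square algebra_simps)
  also have "dist (ey, b) (k, z0) = dist (ex, ey, b) r"
    by (simp add: zs dist2 dist3 power2_eq_square algebra_simps)
  also have "dist (k, z0) (k + h - fx, 0) = dist r (fx, fy, 0)"
    by (simp add: zs dist2 dist3 power2_eq_square algebra_simps)
  also have "dist (k + h - fx, 0) (k + h + x, - (k + y)) = dist (fx, fy, 0) (- x, - y, 0::real)"
    by (simp add: zs dist2 dist3 power2_eq_square algebra_simps)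
  finally show ?thesis by simp
qed

lemma two_corners:
  assumes m: "below_images m h k b x y" and e: "(ex, ey, b) \<in> side_x h k b"
    and r: "r \<in> side_x h k b" "r \<in> side_y h k b"
    and s: "s \<in> side_y h k b" "s \<in> side_x (-h) k b"
    and f: "(fx, fy, 0) \<in> side_x (-h) k b"
  shows "m \<le> dist (x, y, b) (ex, ey, b) + (dist (ex, ey, b) r + (dist r s + (dist s (fx, fy, 0))))
    + dist (fx, fy, 0) (- x, - y, 0::real)"
proof -
  obtain z0 where z0: "r = (h, k, z0)" using r by (auto simp: face_defs)
  obtain z1 where z1: "s = (- h, k, z1)" using s by (auto simp: face_defs)
  have ef: "ex = h" "fx = - h" using e f by (auto simp: face_defs)
  note zs = ef z0 z1
  have "m \<le> dist (y, b + h - x) (2 * k + 2 * h + y, - (h - x))"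
    using m unfolding below_images_def dist2
    by (intro real_le_rsqrt) (simp add: power2_eq_square algebra_simps)
  also have "\<dots> \<le> dist (y, b + h - x) (ey, b) + dist (ey, b) (k, z0) + dist (k, z0) (k + 2 * h, z1) + dist (k + 2 * h, z1) (2 * k + 2 * h - fy, 0) + dist (2 * k + 2 * h - fy, 0) (2 * k + 2 * h + y, - (h - x))"
    by (rule polyline5)
  also have "dist (y, b + h - x) (ey, b) = dist (x, y, b) (ex, ey, b)"
    by (simp add: zs dist2 dist3 power2_eq_square algebra_simps)
  also have "dist (ey, b) (k, z0) = dist (ex, ey, b) r"
    by (simp add: zs dist2 dist3 power2_eq_square algebra_simps)
  also have "dist (k, z0) (k + 2 * h, z1) = dist r s"
    by (simp add: zs dist2 dist3 power2_eq_square algebra_simps)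
  also have "dist (k + 2 * h, z1) (2 * k + 2 * h - fy, 0) = dist s (fx, fy, 0)"
    by (simp add: zs dist2 dist3 power2_eq_square algebra_simps)
  also have "dist (2 * k + 2 * h - fy, 0) (2 * k + 2 * h + y, - (h - x)) = dist (fx, fy, 0) (- x, - y, 0::real)"
    by (simp add: zs dist2 dist3 power2_eq_square algebra_simps)
  finally show ?thesis by simp
qed

lemma three_corners:
  assumes m: "below_images m h k b x y" and e: "(ex, ey, b) \<in> side_x h k b"
    and r: "r \<in> side_x h k b" "r \<in> side_y h k b"
    and s: "s \<in> side_y h k b" "s \<in> side_x (-h) k b"
    and t: "t \<in> side_x (-h) k b" "t \<in> side_y h (-k) b"
    and f: "(fx, fy, 0) \<in> side_y h (-k) b"
  shows "m \<le> dist (x, y, b) (ex, ey, b) + (dist (ex, ey, b) r + (dist r s + (dist s t + (dist t (fx, fy, 0)))))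
    + dist (fx, fy, 0) (- x, - y, 0::real)"
proof -
  obtain z0 where z0: "r = (h, k, z0)" using r by (auto simp: face_defs)
  obtain z1 where z1: "s = (- h, k, z1)" using s by (auto simp: face_defs)
  obtain z2 where z2: "t = (- h, - k, z2)" using t by (auto simp: face_defs)
  have ef: "ex = h" "fy = - k" using e f by (auto simp: face_defs)
  note zs = ef z0 z1 z2
  have "m \<le> dist (y, b + h - x) (3 * k + 3 * h - x, - (k - y))"
    using m unfolding below_images_def dist2
    by (intro real_le_rsqrt) (simp add: power2_eq_square algebra_simps)
  also have "\<dots> \<le> dist (y, b + h - x) (ey, b) + dist (ey, b) (k, z0) + dist (k, z0) (k + 2 * h, z1) + dist (k + 2 * h, z1) (3 * k + 2 * h, z2) + dist (3 * k + 2 * h, z2) (3 * k + 3 * h + fx, 0) + dist (3 * k + 3 * h + fx, 0) (3 * k + 3 * h - x, - (k - y))"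
    by (rule polyline6)
  also have "dist (y, b + h - x) (ey, b) = dist (x, y, b) (ex, ey, b)"
    by (simp add: zs dist2 dist3 power2_eq_square algebra_simps)
  also have "dist (ey, b) (k, z0) = dist (ex, ey, b) r"
    by (simp add: zs dist2 dist3 power2_eq_square algebra_simps)
  also have "dist (k, z0) (k + 2 * h, z1) = dist r s"
    by (simp add: zs dist2 dist3 power2_eq_square algebra_simps)
  also have "dist (k + 2 * h, z1) (3 * k + 2 * h, z2) = dist s t"
    by (simp add: zs dist2 dist3 power2_eq_square algebra_simps)
  also have "dist (3 * k + 2 * h, z2) (3 * k + 3 * h + fx, 0) = dist t (fx, fy, 0)"
    by (simp add: zs dist2 dist3 power2_eq_square algebra_simps)
  also have "dist (3 * k + 3 * h + fx, 0) (3 * k + 3 * h - x, - (k - y)) = dist (fx, fy, 0) (- x, - y, 0::real)"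
    by (simp add: zs dist2 dist3 power2_eq_square algebra_simps)
  finally show ?thesis by simp
qed

text \<open>
  From the side facing \<open>+y\<close>, the remaining faces can only be visited in cyclic order, because
  opposite side faces have no common point.
\<close>

lemma turn_left:
  assumes m: "below_images m h k b x y" and pos: "0 < h" "0 < k"
    and e: "(ex, ey, b) \<in> side_x h k b" and r: "r \<in> side_x h k b"
    and run: "run (side_y h k b) {side_x (-h) k b, side_y h (-k) b} r (fx, fy, 0) l"
  shows "m \<le> dist (x, y, b) (ex, ey, b) + (dist (ex, ey, b) r + l)
    + dist (fx, fy, 0) (- x, - y, 0::real)"
proof -
  let ?R = "side_x h k b" and ?U = "side_y h k b" and ?L = "side_x (-h) k b"
    and ?D = "side_y h (-k) b"
  have rU: "r \<in> ?U" using run by (simp add: run_def)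
  from run consider "(fx, fy, 0) \<in> ?U" "l = dist r (fx, fy, 0)"
    | s l' where "s \<in> ?U" "l = dist r s + l'" "chain {?L, ?D} s (fx, fy, 0) l'"
    unfolding run_def by blast
  then show ?thesis
  proof cases
    case 1
    then show ?thesis using one_corner[OF m e r rU] by simp
  next
    case 2
    have "s \<notin> ?D" using 2(1) pos by (auto simp: face_defs)
    then have "run ?L {?D} s (fx, fy, 0) l'"
      using chain_run[OF 2(3)] run_mono[of ?L "{?L, ?D} - {?L}"] by (auto simp: run_def)
    then have sL: "s \<in> ?L" and
      "(fx, fy, 0) \<in> ?L \<and> l' = dist s (fx, fy, 0) \<or>
       (\<exists>t l''. t \<in> ?L \<and> l' = dist s t + l'' \<and> chain {?D} t (fx, fy, 0) l'')"
      by (auto simp: run_def)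
    then consider "(fx, fy, 0) \<in> ?L" "l' = dist s (fx, fy, 0)"
      | t l'' where "t \<in> ?L" "l' = dist s t + l''" "chain {?D} t (fx, fy, 0) l''"
      by blast
    then show ?thesis
    proof cases
      case 1
      then show ?thesis using two_corners[OF m e r rU 2(1) sL] 2(2) by simp
    next
      case t: 2
      have "\<not> chain {} u v w" for u v :: "real \<times> real \<times> real" and w
        by (auto elim: chain.cases)
      then have "t \<in> ?D" "(fx, fy, 0) \<in> ?D" "l'' = dist t (fx, fy, 0)"
        using chain_run[OF t(3)] by (auto simp: run_def)
      then show ?thesis using three_corners[OF m e r rU 2(1) sL t(1)] t(2) 2(2) by simp
    qed
  qed
qed

text \<open>
  Turning towards \<open>-y\<close> is turning towards \<open>+y\<close> in the box reflected by \<open>flip_y\<close>.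
\<close>

lemma from_side_x:
  assumes m: "below_images m h k b x y" and pos: "0 < h" "0 < k"
    and run: "run (side_x h k b) {side_y h k b, side_x (-h) k b, side_y h (-k) b}
      (ex, ey, b) (fx, fy, 0) l"
  shows "m \<le> dist (x, y, b) (ex, ey, b) + l + dist (fx, fy, 0) (- x, - y, 0::real)"
proof -
  let ?R = "side_x h k b" and ?U = "side_y h k b" and ?L = "side_x (-h) k b"
    and ?D = "side_y h (-k) b"
  have e: "(ex, ey, b) \<in> ?R" using run by (simp add: run_def)
  from run consider "(fx, fy, 0) \<in> ?R" "l = dist (ex, ey, b) (fx, fy, 0)"
    | r l' where "r \<in> ?R" "l = dist (ex, ey, b) r + l'" "chain {?U, ?L, ?D} r (fx, fy, 0) l'"
    unfolding run_def by blast
  then show ?thesis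
  proof cases
    case 1
    then show ?thesis using no_corner[OF m e] by simp
  next
    case r: 2
    obtain F where F: "F \<in> {?U, ?L, ?D}" "run F ({?U, ?L, ?D} - {F}) r (fx, fy, 0) l'"
      using chain_run[OF r(3)] by blast
    have "r \<notin> ?L" using r(1) pos by (auto simp: face_defs)
    moreover have "r \<in> F" using F(2) by (simp add: run_def)
    ultimately consider "F = ?U" | "F = ?D" using F(1) by blast
    then show ?thesis
    proof cases
      case 1
      have "run ?U {?L, ?D} r (fx, fy, 0) l'"
        by (rule run_mono[OF F(2)[unfolded 1]]) auto
      then show ?thesis using turn_left[OF m pos e r(1)] r(2) by simp
    next
      case 2
      have "run ?D {?U, ?L} r (fx, fy, 0) l'"
        by (rule run_mono[OF F(2)[unfolded 2]]) auto
      from run_image[of flip_y, OF dist_flip_y this]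
      have "run ?U {?L, ?D} (flip_y r) (fx, - fy, 0) l'"
        by (simp add: image_flip_y insert_commute)
      moreover have "flip_y r \<in> ?R" "(ex, - ey, b) \<in> ?R"
        using imageI[OF r(1), of flip_y] imageI[OF e, of flip_y] by (simp_all add: image_flip_y)
      ultimately have "m \<le> dist (x, - y, b) (ex, - ey, b) + (dist (ex, - ey, b) (flip_y r) + l')
          + dist (fx, - fy, 0) (- x, - (- y), 0::real)"
        by (intro turn_left[OF below_images_flip_y[OF m] pos])
      then show ?thesis
        using r(2) dist_flip_y[of "(x, y, b)" "(ex, ey, b)"] dist_flip_y[of "(ex, ey, b)" r]
          dist_flip_y[of "(fx, fy, 0)" "(- x, - y, 0)"] by simp
    qed
  qed
qed

lemma from_side_y:
  assumes m: "below_images m h k b x y" and pos: "0 < h" "0 < k"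
    and run: "run (side_y h k b) {side_x h k b, side_x (-h) k b, side_y h (-k) b}
      (ex, ey, b) (fx, fy, 0) l"
  shows "m \<le> dist (x, y, b) (ex, ey, b) + l + dist (fx, fy, 0) (- x, - y, 0::real)"
proof -
  have "m \<le> dist (y, x, b) (ey, ex, b) + l + dist (fy, fx, 0) (- y, - x, 0::real)"
    using run_image[of swap_xy, OF dist_swap_xy run]
    by (intro from_side_x[OF below_images_swap_xy[OF m] pos(2,1)])
      (simp add: image_swap_xy insert_commute)
  then show ?thesis
    using dist_swap_xy[of "(x, y, b)" "(ex, ey, b)"]
      dist_swap_xy[of "(fx, fy, 0)" "(- x, - y, 0)"] by simp
qed

lemma from_side_minus_y:
  assumes m: "below_images m h k b x y" and pos: "0 < h" "0 < k"
    and run: "run (side_y h (-k) b) {side_x h k b, side_x (-h) k b, side_y h k b}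
      (ex, ey, b) (fx, fy, 0) l"
  shows "m \<le> dist (x, y, b) (ex, ey, b) + l + dist (fx, fy, 0) (- x, - y, 0::real)"
proof -
  have "m \<le> dist (x, - y, b) (ex, - ey, b) + l + dist (fx, - fy, 0) (- x, - (- y), 0::real)"
    using run_image[of flip_y, OF dist_flip_y run]
    by (intro from_side_y[OF below_images_flip_y[OF m] pos])
      (simp add: image_flip_y insert_commute)
  then show ?thesis
    using dist_flip_y[of "(x, y, b)" "(ex, ey, b)"]
      dist_flip_y[of "(fx, fy, 0)" "(- x, - y, 0)"] by simp
qed

lemma from_side_minus_x:
  assumes m: "below_images m h k b x y" and pos: "0 < h" "0 < k"
    and run: "run (side_x (-h) k b) {side_x h k b, side_y h k b, side_y h (-k) b}
      (ex, ey, b) (fx, fy, 0) l"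
  shows "m \<le> dist (x, y, b) (ex, ey, b) + l + dist (fx, fy, 0) (- x, - y, 0::real)"
proof -
  have "m \<le> dist (y, x, b) (ey, ex, b) + l + dist (fy, fx, 0) (- y, - x, 0::real)"
    using run_image[of swap_xy, OF dist_swap_xy run]
    by (intro from_side_minus_y[OF below_images_swap_xy[OF m] pos(2,1)])
      (simp add: image_swap_xy insert_commute)
  then show ?thesis
    using dist_swap_xy[of "(x, y, b)" "(ex, ey, b)"]
      dist_swap_xy[of "(fx, fy, 0)" "(- x, - y, 0)"] by simp
qed

lemma from_any_side:
  assumes m: "below_images m h k b x y" and pos: "0 < h" "0 < k"
    and c: "chain (sides h k b) (ex, ey, b) (fx, fy, 0) l"
  shows "m \<le> dist (x, y, b) (ex, ey, b) + l + dist (fx, fy, 0) (- x, - y, 0::real)"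
proof -
  obtain F where F: "F \<in> sides h k b" and run: "run F (sides h k b - {F}) (ex, ey, b) (fx, fy, 0) l"
    using chain_run[OF c] by blast
  from F consider "F = side_x h k b" | "F = side_y h k b" | "F = side_y h (-k) b"
    | "F = side_x (-h) k b"
    unfolding sides_def by blast
  then show ?thesis
  proof cases
    case 1
    show ?thesis
      by (rule from_side_x[OF m pos run_mono[OF run[unfolded 1]]]) (auto simp: sides_def)
  next
    case 2
    show ?thesis
      by (rule from_side_y[OF m pos run_mono[OF run[unfolded 2]]]) (auto simp: sides_def)
  next
    case 3
    show ?thesis
      by (rule from_side_minus_y[OF m pos run_mono[OF run[unfolded 3]]]) (auto simp: sides_def)
  next
    case 4
    show ?thesis
      by (rule from_side_minus_x[OF m pos run_mono[OF run[unfolded 4]]]) (auto simp: sides_def)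
  qed
qed

lemma path_length_ge:
  assumes m: "below_images m h k b x y" and pos: "0 < h" "0 < k" "0 < b"
    and g: "g \<in> paths_within (shell h k b) (x, y, b) (- x, - y, 0)"
    and xy: "\<bar>x\<bar> \<le> h" "\<bar>y\<bar> \<le> k"
  shows "ennreal m \<le> path_length g"
proof -
  have cont: "continuous_on {0..1} g" and img: "g ` {0..1} \<subseteq> shell h k b"
    and ends: "g 0 = (x, y, b)" "g 1 = (- x, - y, 0)"
    using g by (auto simp: paths_within_def path_def path_image_def pathstart_def pathfinish_def)
  have closed: "closed (lid h k c)" "F \<in> sides h k b \<Longrightarrow> closed F" for c F
    unfolding sides_def face_defs by (auto intro!: closed_Times)
  have disj: "lid h k b \<inter> lid h k 0 = {}" using pos by (auto simp: lid_def)
  define T where "T = {0..1} \<inter> g -` lid h k b"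
  have "closed T" unfolding T_def by (intro continuous_closed_preimage cont closed closed_atLeastAtMost)
  then have "compact T"
    using compact_Int_closed[of "{0..1}" T] by (simp add: T_def Int_assoc[symmetric])
  moreover have "0 \<in> T" using ends xy by (auto simp: T_def lid_def)
  ultimately obtain u where u: "u \<in> T" "\<And>v. v \<in> T \<Longrightarrow> v \<le> u"
    using compact_attains_sup[of T] by blast
  then have u01: "0 \<le> u" "u \<le> 1" "g u \<in> lid h k b" by (auto simp: T_def)
  define B where "B = {u..1} \<inter> g -` lid h k 0"
  have "continuous_on {u..1} g" using cont u01 by (auto intro: continuous_on_subset)
  then have "closed B" unfolding B_def
    by (intro continuous_closed_preimage closed closed_atLeastAtMost)
  then have "compact B"
    using compact_Int_closed[of "{u..1}" B] by (simp add: B_def Int_assoc[symmetric])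
  moreover have "1 \<in> B" using ends xy u01 by (auto simp: B_def lid_def)
  ultimately obtain v where v: "v \<in> B" "\<And>w. w \<in> B \<Longrightarrow> v \<le> w"
    using compact_attains_inf[of B] by blast
  then have uv: "u \<le> v" "v \<le> 1" "g v \<in> lid h k 0" by (auto simp: B_def)
  have "u < v" using uv u01 disj by (cases "u = v") auto
  define C where "C = {0..1} \<inter> g -` \<Union>(sides h k b)"
  have "finite (sides h k b)" by (simp add: sides_def)
  then have "closed C"
    unfolding C_def by (intro continuous_closed_preimage cont closed_Union closed_atLeastAtMost) (auto simp: closed)
  have "{u<..<v} \<subseteq> C"
  proof
    fix w assume w: "w \<in> {u<..<v}"
    have w01: "w \<in> {0..1}" using w u01 uv by simp
    have "g w \<notin> lid h k b" using u(2)[of w] w w01 by (auto simp: T_def)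
    moreover have "g w \<notin> lid h k 0" using v(2)[of w] w w01 by (auto simp: B_def)
    moreover have "g w \<in> shell h k b" by (rule subsetD[OF img imageI[OF w01]])
    ultimately show "w \<in> C" using w01 by (auto simp: C_def shell_def)
  qed
  then have "closure {u<..<v} \<subseteq> C" using \<open>closed C\<close> by (simp add: closure_minimal)
  then have "{u..v} \<subseteq> C" using \<open>u < v\<close> by simp
  then have img_uv: "g ` {u..v} \<subseteq> \<Union>(sides h k b)" unfolding C_def by blast
  obtain ex ey where e: "g u = (ex, ey, b)" using u01(3) by (auto simp: lid_def)
  obtain fx fy where f: "g v = (fx, fy, 0)" using uv(3) by (auto simp: lid_def)
  have "inscribed g v 1 (dist (g v) (g 1) + 0)"
    using uv by (intro inscribed_Cons inscribed_refl) auto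
  moreover have "continuous_on {u..v} g" using cont u01 uv by (auto intro: continuous_on_subset)
  ultimately obtain l where c: "chain (sides h k b) (g u) (g v) l"
    and l: "inscribed g u 1 (l + (dist (g v) (g 1) + 0))"
    using path_chain[of "sides h k b" u v g] \<open>finite (sides h k b)\<close> closed(2) uv img_uv by blast
  have "m \<le> dist (x, y, b) (ex, ey, b) + l + dist (fx, fy, 0) (- x, - y, 0::real)"
    using from_any_side[OF m pos(1,2)] c by (simp add: e f)
  moreover have "inscribed g 0 1 (dist (g 0) (g u) + (l + (dist (g v) (g 1) + 0)))"
    using u01 l by (intro inscribed_Cons) auto
  ultimately have "ennreal m \<le> ennreal (dist (g 0) (g u) + (l + (dist (g v) (g 1) + 0)))"
    by (intro ennreal_leI) (simp add: e f ends)
  also have "\<dots> \<le> path_length g" by (rule inscribed_le_path_length) fact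
  finally show ?thesis .
qed

section \<open>The upper bound: paths realising the candidates\<close>

lemma face_convex:
  assumes "F \<in> {lid h k b, lid h k 0} \<union> sides h k b"
  shows "convex F" "F \<subseteq> shell h k b"
proof -
  show "convex F" using assms unfolding sides_def face_defs by (auto simp: convex_Times)
  show "F \<subseteq> shell h k b" using assms unfolding shell_def by auto
qed

text \<open>
  One face's share \<open>t\<close> of an unfolded segment with horizontal extent \<open>X\<close> and vertical extent \<open>Y\<close>.
\<close>

lemma reach_fraction:
  assumes F: "F \<in> {lid h k b, lid h k 0} \<union> sides h k b"
    and "(x, y, z) \<in> F" "(x', y', z') \<in> F" "0 \<le> t"
    and d: "(x - x')\<^sup>2 + (y - y')\<^sup>2 + (z - z')\<^sup>2 = (t * X)\<^sup>2 + (t * Y)\<^sup>2"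
  shows "reach (shell h k b) (x, y, z) (x', y', z') (t * sqrt (X\<^sup>2 + Y\<^sup>2))"
proof -
  have "dist (x, y, z) (x', y', z') = sqrt (t\<^sup>2 * (X\<^sup>2 + Y\<^sup>2))"
    by (simp add: dist3 d power_mult_distrib distrib_left)
  also have "\<dots> = t * sqrt (X\<^sup>2 + Y\<^sup>2)"
    using assms(4) by (simp add: real_sqrt_mult)
  finally show ?thesis using reach_segment[OF face_convex[OF F] assms(2,3)] by simp
qed

lemma straight_over_side_x:
  assumes pos: "0 < h" "0 < k" "0 < b" and xy: "\<bar>x\<bar> \<le> h" "\<bar>y\<bar> \<le> k"
  shows "reach (shell h k b) (x, y, b) (- x, - y, 0) (sqrt ((2*y)\<^sup>2 + (2*h + b)\<^sup>2))"
proof -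
  define Y where "Y = 2*h + b"
  define t\<^sub>1 where "t\<^sub>1 = (h - x) / Y"
  define t\<^sub>2 where "t\<^sub>2 = b / Y"
  define t\<^sub>3 where "t\<^sub>3 = (h + x) / Y"
  have "Y > 0" using pos by (simp add: Y_def)
  then have tY: "t\<^sub>1 * Y = h - x" "t\<^sub>2 * Y = b" "t\<^sub>3 * Y = h + x"
    by (simp_all add: t\<^sub>1_def t\<^sub>2_def t\<^sub>3_def)
  have t: "0 \<le> t\<^sub>1" "0 \<le> t\<^sub>2" "0 \<le> t\<^sub>3"
    using \<open>Y > 0\<close> pos xy by (auto simp: t\<^sub>1_def t\<^sub>2_def t\<^sub>3_def)
  have "(t\<^sub>1 + t\<^sub>2 + t\<^sub>3) * Y = 1 * Y" using tY by (simp add: distrib_right Y_def)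
  then have sum: "t\<^sub>1 + t\<^sub>2 + t\<^sub>3 = 1" using \<open>Y > 0\<close> by (metis mult_right_cancel less_irrefl)
  have inside: "\<bar>y - t * (2*y)\<bar> \<le> k" if "0 \<le> t" "t \<le> 1" for t
  proof -
    have "\<bar>y - t * (2*y)\<bar> = \<bar>1 - 2*t\<bar> * \<bar>y\<bar>"
      unfolding abs_mult[symmetric] by (simp add: algebra_simps)
    also have "\<dots> \<le> 1 * k" using that xy by (intro mult_mono) auto
    finally show ?thesis by simp
  qed
  let ?c = "y - t\<^sub>1 * (2*y)" and ?c' = "- (y - t\<^sub>3 * (2*y))"
  have c: "\<bar>?c\<bar> \<le> k" "\<bar>?c'\<bar> \<le> k"
    unfolding abs_minus_cancel using t sum by (auto intro!: inside)
  have "?c - ?c' = (1 - t\<^sub>1 - t\<^sub>3) * (2*y)" by (simp add: algebra_simps)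
  moreover have "1 - t\<^sub>1 - t\<^sub>3 = t\<^sub>2" using sum by simp
  ultimately have cc: "?c - ?c' = t\<^sub>2 * (2*y)" by simp
  let ?L = "sqrt ((2*y)\<^sup>2 + Y\<^sup>2)"
  have "reach (shell h k b) (x, y, b) (h, ?c, b) (t\<^sub>1 * ?L)"
    by (rule reach_fraction[of "lid h k b"])
      (use t tY c xy pos in \<open>auto simp: sides_def lid_def power2_commute abs_le_iff\<close>)
  moreover have "reach (shell h k b) (h, ?c, b) (h, ?c', 0) (t\<^sub>2 * ?L)"
    by (rule reach_fraction[of "side_x h k b"])
      (use t c pos in \<open>auto simp: cc[simplified] tY sides_def side_x_def abs_le_iff\<close>)
  moreover have "reach (shell h k b) (h, ?c', 0) (- x, - y, 0) (t\<^sub>3 * ?L)"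
    by (rule reach_fraction[of "lid h k 0"])
      (use t tY c xy pos in \<open>auto simp: sides_def lid_def abs_le_iff\<close>)
  ultimately have "reach (shell h k b) (x, y, b) (- x, - y, 0) (t\<^sub>1 * ?L + t\<^sub>2 * ?L + t\<^sub>3 * ?L)"
    by (blast intro: reach_trans)
  also have "t\<^sub>1 * ?L + t\<^sub>2 * ?L + t\<^sub>3 * ?L = (t\<^sub>1 + t\<^sub>2 + t\<^sub>3) * ?L"
    by (simp only: distrib_right)
  finally show ?thesis by (simp add: sum Y_def)
qed

lemma straight_over_side_y:
  assumes pos: "0 < h" "0 < k" "0 < b" and xy: "\<bar>x\<bar> \<le> h" "\<bar>y\<bar> \<le> k"
  shows "reach (shell h k b) (x, y, b) (- x, - y, 0) (sqrt ((2*x)\<^sup>2 + (2*k + b)\<^sup>2))"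
  using reach_image[of swap_xy, OF dist_swap_xy straight_over_side_x[OF pos(2,1,3) xy(2,1)]]
  by (simp add: shell_swap_xy)

text \<open>
  The unfolded segment over the sides facing \<open>+x\<close> and \<open>+y\<close> is a path on the box unless it passes
  the upper or the lower end of their common edge on the wrong side.  If so, turning the top or
  the bottom about that corner leaves a segment over only one of the two sides, and that is shorter.
\<close>

lemma over_two_sides:
  assumes pos: "0 < h" "0 < k" "0 < b" and xy: "0 \<le> x" "x \<le> h" "\<bar>y\<bar> \<le> k"
  shows "\<exists>l. reach (shell h k b) (x, y, b) (- x, - y, 0) l \<and>
    l\<^sup>2 \<le> (h + k + x - y)\<^sup>2 + (b + h + k - x + y)\<^sup>2"
proof -
  define X where "X = h + k + x - y"
  define Y where "Y = b + h + k - x + y"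
  have X: "X > 0" and Y: "Y > 0" using pos xy by (auto simp: X_def Y_def)
  note prods = mult_nonneg_nonneg[of "h + x" "k - y"] mult_nonneg_nonneg[of "k + y" "b + h - x"]
    mult_nonneg_nonneg[of "h - x" "b + k + y"]
  \<comment> \<open>The segment reaches the height \<open>b\<close> after the fraction \<open>(h - x) / Y\<close> and the common edge of the
    two sides after the fraction \<open>(k - y) / X\<close>; likewise from the other end.\<close>
  consider (top) "(h - x) * X > (k - y) * Y" | (bottom) "(k + y) * X > (h + x) * Y"
    | (inside) "(h - x) * X \<le> (k - y) * Y" "(k + y) * X \<le> (h + x) * Y" by linarith
  then show ?thesis
  proof cases
    case top
    have "X\<^sup>2 + Y\<^sup>2 - ((2*x)\<^sup>2 + (2*k + b)\<^sup>2) =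
      2 * (((h - x) * X - (k - y) * Y) + (h + x) * (k - y) + (h - x) * (b + k + y))"
      by (simp add: X_def Y_def power2_eq_square algebra_simps)
    also have "\<dots> \<ge> 0" using top prods pos xy by (auto simp: abs_le_iff)
    finally show ?thesis
      using straight_over_side_y[of h k b x y] pos xy by (auto simp: X_def Y_def)
  next
    case bottom
    have "X\<^sup>2 + Y\<^sup>2 - ((2*y)\<^sup>2 + (2*h + b)\<^sup>2) =
      2 * (((k + y) * X - (h + x) * Y) + (h + x) * (k - y) + (k + y) * (b + h - x))"
      by (simp add: X_def Y_def power2_eq_square algebra_simps)
    also have "\<dots> \<ge> 0" using bottom prods pos xy by (auto simp: abs_le_iff)
    finally show ?thesis
      using straight_over_side_x[of h k b x y] pos xy by (auto simp: X_def Y_def)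
  next
    case inside
    define t\<^sub>1 where "t\<^sub>1 = (h - x) / Y"
    define t\<^sub>2 where "t\<^sub>2 = (k - y) / X"
    define t\<^sub>4 where "t\<^sub>4 = (k + y) / Y"
    have t: "0 \<le> t\<^sub>1" "0 \<le> t\<^sub>4" using X Y xy by (auto simp: t\<^sub>1_def t\<^sub>4_def)
    have eqs: "t\<^sub>1 * Y = h - x" "t\<^sub>2 * X = k - y" "t\<^sub>4 * Y = k + y"
      using X Y by (simp_all add: t\<^sub>1_def t\<^sub>2_def t\<^sub>4_def)
    have le: "t\<^sub>1 * X \<le> k - y" "t\<^sub>4 * X \<le> h + x"
      using inside Y by (simp_all add: t\<^sub>1_def t\<^sub>4_def pos_divide_le_eq)
    have "t\<^sub>1 * X \<le> t\<^sub>2 * X" using le eqs by simp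
    then have t12: "t\<^sub>1 \<le> t\<^sub>2" using X by simp
    have "t\<^sub>2 * X \<le> (1 - t\<^sub>4) * X" using le eqs by (simp add: left_diff_distrib X_def)
    then have t24: "t\<^sub>2 \<le> 1 - t\<^sub>4" using X by (simp only: mult_le_cancel_right_pos)
    have "t\<^sub>1 * Y \<le> t\<^sub>2 * Y" "t\<^sub>2 * Y \<le> (1 - t\<^sub>4) * Y"
      using t12 t24 Y by (auto intro: mult_right_mono)
    then have z: "0 \<le> b + h - x - t\<^sub>2 * Y" "b + h - x - t\<^sub>2 * Y \<le> b"
      using eqs by (simp_all add: left_diff_distrib Y_def)
    have tX: "0 \<le> t\<^sub>1 * X" "0 \<le> t\<^sub>4 * X" using t X by auto
    let ?L = "sqrt (X\<^sup>2 + Y\<^sup>2)"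
    let ?r = "(h, k, b + h - x - t\<^sub>2 * Y)"
    have "reach (shell h k b) (x, y, b) (h, y + t\<^sub>1 * X, b) (t\<^sub>1 * ?L)"
      by (rule reach_fraction[of "lid h k b"])
        (use t eqs le tX xy pos in \<open>auto simp: sides_def lid_def power2_commute abs_le_iff\<close>)
    moreover have "reach (shell h k b) (h, y + t\<^sub>1 * X, b) ?r ((t\<^sub>2 - t\<^sub>1) * ?L)"
    proof (rule reach_fraction[of "side_x h k b"])
      have "y + t\<^sub>1 * X - k = - ((t\<^sub>2 - t\<^sub>1) * X)" "b - (b + h - x - t\<^sub>2 * Y) = (t\<^sub>2 - t\<^sub>1) * Y"
        using eqs by (simp_all add: algebra_simps)
      then show "(h - h)\<^sup>2 + (y + t\<^sub>1 * X - k)\<^sup>2 + (b - (b + h - x - t\<^sub>2 * Y))\<^sup>2 =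
        ((t\<^sub>2 - t\<^sub>1) * X)\<^sup>2 + ((t\<^sub>2 - t\<^sub>1) * Y)\<^sup>2" by simp
    qed (use t12 le tX z xy pos in \<open>auto simp: sides_def side_x_def abs_le_iff\<close>)
    moreover have "reach (shell h k b) ?r (- x + t\<^sub>4 * X, k, 0) ((1 - t\<^sub>4 - t\<^sub>2) * ?L)"
    proof (rule reach_fraction[of "side_y h k b"])
      have "h - (- x + t\<^sub>4 * X) = (1 - t\<^sub>4 - t\<^sub>2) * X" "b + h - x - t\<^sub>2 * Y - 0 = (1 - t\<^sub>4 - t\<^sub>2) * Y"
        using eqs by (simp_all add: left_diff_distrib) (simp_all add: X_def Y_def)
      then show "(h - (- x + t\<^sub>4 * X))\<^sup>2 + (k - k)\<^sup>2 + (b + h - x - t\<^sub>2 * Y - 0)\<^sup>2 =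
        ((1 - t\<^sub>4 - t\<^sub>2) * X)\<^sup>2 + ((1 - t\<^sub>4 - t\<^sub>2) * Y)\<^sup>2" by simp
    qed (use t24 le tX z xy pos in \<open>auto simp: sides_def side_y_def abs_le_iff\<close>)
    moreover have "reach (shell h k b) (- x + t\<^sub>4 * X, k, 0) (- x, - y, 0) (t\<^sub>4 * ?L)"
      by (rule reach_fraction[of "lid h k 0"])
        (use t eqs le tX xy pos in \<open>auto simp: sides_def lid_def abs_le_iff\<close>)
    ultimately have "reach (shell h k b) (x, y, b) (- x, - y, 0)
        (t\<^sub>1 * ?L + (t\<^sub>2 - t\<^sub>1) * ?L + (1 - t\<^sub>4 - t\<^sub>2) * ?L + t\<^sub>4 * ?L)"
      by (blast intro: reach_trans)
    also have "t\<^sub>1 * ?L + (t\<^sub>2 - t\<^sub>1) * ?L + (1 - t\<^sub>4 - t\<^sub>2) * ?L + t\<^sub>4 * ?L = ?L"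
      by (simp add: left_diff_distrib)
    finally show ?thesis by (intro exI[of _ ?L]) (simp add: X_def Y_def)
  qed
qed

lemma over_two_sides_flip:
  assumes pos: "0 < h" "0 < k" "0 < b" and xy: "0 \<le> x" "x \<le> h" "\<bar>y\<bar> \<le> k"
  shows "\<exists>l. reach (shell h k b) (x, y, b) (- x, - y, 0) l \<and>
    l\<^sup>2 \<le> (h + k + x + y)\<^sup>2 + (b + h + k - x - y)\<^sup>2"
proof -
  obtain l where l: "reach (shell h k b) (x, - y, b) (- x, - (- y), 0) l"
    "l\<^sup>2 \<le> (h + k + x - (- y))\<^sup>2 + (b + h + k - x + (- y))\<^sup>2"
    using over_two_sides[of h k b x "- y"] pos xy by auto
  have "reach (shell h k b) (x, y, b) (- x, - y, 0) l"
    using reach_image[of flip_y, OF dist_flip_y l(1)] by (simp add: shell_flip_y)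
  then show ?thesis using l(2) by auto
qed

text \<open>
  The unfolding over the sides facing \<open>+x\<close>, \<open>+y\<close>, \<open>-x\<close> is invariant under the half turn that
  exchanges the end points, so the segment meets the top edge and the bottom edge at the same
  fraction \<open>t\<^sub>1\<close> from either end.  If it misses the top edge, a quarter turn of the top about the
  corner \<open>(h, k, b)\<close> leaves the unfolding over \<open>+y\<close>, \<open>-x\<close>, which the central reflection of the
  box, together with reversal of the path, carries to the one over \<open>+x\<close>, \<open>-y\<close>.
\<close>

lemma over_three_sides:
  assumes pos: "0 < h" "0 < k" "0 < b" and xy: "0 \<le> x" "x \<le> h" "0 \<le> y" "y \<le> k"
  shows "\<exists>l. reach (shell h k b) (x, y, b) (- x, - y, 0) l \<and>
    l\<^sup>2 \<le> (2*(h + k))\<^sup>2 + (b + 2*h - 2*x)\<^sup>2"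
proof -
  define X where "X = 2*(h + k)"
  define Y where "Y = b + 2*h - 2*x"
  have X: "X > 0" and Y: "Y > 0" using pos xy by (auto simp: X_def Y_def)
  show ?thesis
  proof (cases "(h - x) * X \<le> (k - y) * Y")
    case False
    have "X\<^sup>2 + Y\<^sup>2 - ((h + k + x + y)\<^sup>2 + (b + h + k - x - y)\<^sup>2) =
      2 * (((h - x) * X - (k - y) * Y) + (k - y) * (k + y + 2*h) + (h - x) * (b + h - x))"
      by (simp add: X_def Y_def power2_eq_square algebra_simps)
    also have "\<dots> \<ge> 0"
      using False mult_nonneg_nonneg[of "k - y" "k + y + 2*h"]
        mult_nonneg_nonneg[of "h - x" "b + h - x"] pos xy by auto
    finally show ?thesis
      using over_two_sides_flip[OF pos xy(1,2), of y] xy by (auto simp: X_def Y_def)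
  next
    case inside: True
    define t\<^sub>1 where "t\<^sub>1 = (h - x) / Y"
    define t\<^sub>2 where "t\<^sub>2 = (k - y) / X"
    define t\<^sub>3 where "t\<^sub>3 = (k - y + 2*h) / X"
    have t: "0 \<le> t\<^sub>1" using X Y xy by (auto simp: t\<^sub>1_def)
    have eqs: "t\<^sub>1 * Y = h - x" "t\<^sub>2 * X = k - y" "t\<^sub>3 * X = k - y + 2*h"
      using X Y by (simp_all add: t\<^sub>1_def t\<^sub>2_def t\<^sub>3_def)
    have le: "t\<^sub>1 * X \<le> k - y"
      using inside Y by (simp add: t\<^sub>1_def pos_divide_le_eq)
    have "t\<^sub>1 * X \<le> t\<^sub>2 * X" "t\<^sub>2 * X \<le> t\<^sub>3 * X" using le eqs pos by simp_all
    then have t123: "t\<^sub>1 \<le> t\<^sub>2" "t\<^sub>2 \<le> t\<^sub>3" using X by simp_all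
    have "t\<^sub>3 * X \<le> (1 - t\<^sub>1) * X" using le eqs xy by (simp add: left_diff_distrib) (simp add: X_def)
    then have t31: "t\<^sub>3 \<le> 1 - t\<^sub>1" using X by (simp only: mult_le_cancel_right_pos)
    have "t\<^sub>1 * Y \<le> t\<^sub>2 * Y" "t\<^sub>2 * Y \<le> t\<^sub>3 * Y" "t\<^sub>3 * Y \<le> (1 - t\<^sub>1) * Y"
      using t123 t31 Y by (auto intro: mult_right_mono)
    then have z: "0 \<le> b + h - x - t\<^sub>2 * Y" "b + h - x - t\<^sub>2 * Y \<le> b"
      "0 \<le> b + h - x - t\<^sub>3 * Y" "b + h - x - t\<^sub>3 * Y \<le> b"
      using eqs by (simp_all add: left_diff_distrib Y_def)
    have tX: "0 \<le> t\<^sub>1 * X" using t X by auto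
    let ?L = "sqrt (X\<^sup>2 + Y\<^sup>2)"
    let ?r = "(h, k, b + h - x - t\<^sub>2 * Y)" and ?s = "(- h, k, b + h - x - t\<^sub>3 * Y)"
    have "reach (shell h k b) (x, y, b) (h, y + t\<^sub>1 * X, b) (t\<^sub>1 * ?L)"
      by (rule reach_fraction[of "lid h k b"])
        (use t eqs le tX xy pos in \<open>auto simp: sides_def lid_def power2_commute\<close>)
    moreover have "reach (shell h k b) (h, y + t\<^sub>1 * X, b) ?r ((t\<^sub>2 - t\<^sub>1) * ?L)"
    proof (rule reach_fraction[of "side_x h k b"])
      have "y + t\<^sub>1 * X - k = - ((t\<^sub>2 - t\<^sub>1) * X)" "b - (b + h - x - t\<^sub>2 * Y) = (t\<^sub>2 - t\<^sub>1) * Y"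
        using eqs by (simp_all add: algebra_simps)
      then show "(h - h)\<^sup>2 + (y + t\<^sub>1 * X - k)\<^sup>2 + (b - (b + h - x - t\<^sub>2 * Y))\<^sup>2 =
        ((t\<^sub>2 - t\<^sub>1) * X)\<^sup>2 + ((t\<^sub>2 - t\<^sub>1) * Y)\<^sup>2" by simp
    qed (use t123 le tX z xy pos in \<open>auto simp: sides_def side_x_def\<close>)
    moreover have "reach (shell h k b) ?r ?s ((t\<^sub>3 - t\<^sub>2) * ?L)"
    proof (rule reach_fraction[of "side_y h k b"])
      have "h - (- h) = (t\<^sub>3 - t\<^sub>2) * X"
        "b + h - x - t\<^sub>2 * Y - (b + h - x - t\<^sub>3 * Y) = (t\<^sub>3 - t\<^sub>2) * Y"
        using eqs by (simp_all add: left_diff_distrib)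
      then show "(h - (- h))\<^sup>2 + (k - k)\<^sup>2 + (b + h - x - t\<^sub>2 * Y - (b + h - x - t\<^sub>3 * Y))\<^sup>2 =
        ((t\<^sub>3 - t\<^sub>2) * X)\<^sup>2 + ((t\<^sub>3 - t\<^sub>2) * Y)\<^sup>2" by simp
    qed (use t123 z pos in \<open>auto simp: sides_def side_y_def\<close>)
    moreover have "reach (shell h k b) ?s (- h, - y + t\<^sub>1 * X, 0) ((1 - t\<^sub>1 - t\<^sub>3) * ?L)"
    proof (rule reach_fraction[of "side_x (-h) k b"])
      have "k - (- y + t\<^sub>1 * X) = (1 - t\<^sub>1 - t\<^sub>3) * X"
        "b + h - x - t\<^sub>3 * Y - 0 = (1 - t\<^sub>1 - t\<^sub>3) * Y"
        using eqs by (simp_all add: left_diff_distrib) (simp_all add: X_def Y_def)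
      then show "(- h - - h)\<^sup>2 + (k - (- y + t\<^sub>1 * X))\<^sup>2 + (b + h - x - t\<^sub>3 * Y - 0)\<^sup>2 =
        ((1 - t\<^sub>1 - t\<^sub>3) * X)\<^sup>2 + ((1 - t\<^sub>1 - t\<^sub>3) * Y)\<^sup>2" by simp
    qed (use t31 le tX z xy pos in \<open>auto simp: sides_def side_x_def\<close>)
    moreover have "reach (shell h k b) (- h, - y + t\<^sub>1 * X, 0) (- x, - y, 0) (t\<^sub>1 * ?L)"
      by (rule reach_fraction[of "lid h k 0"])
        (use t eqs le tX xy pos in \<open>auto simp: sides_def lid_def power2_commute\<close>)
    ultimately have "reach (shell h k b) (x, y, b) (- x, - y, 0)
        (t\<^sub>1 * ?L + (t\<^sub>2 - t\<^sub>1) * ?L + (t\<^sub>3 - t\<^sub>2) * ?L + (1 - t\<^sub>1 - t\<^sub>3) * ?L + t\<^sub>1 * ?L)"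
      by (blast intro: reach_trans)
    also have "t\<^sub>1 * ?L + (t\<^sub>2 - t\<^sub>1) * ?L + (t\<^sub>3 - t\<^sub>2) * ?L + (1 - t\<^sub>1 - t\<^sub>3) * ?L + t\<^sub>1 * ?L = ?L"
      by (simp add: left_diff_distrib)
    finally show ?thesis by (intro exI[of _ ?L]) (simp add: X_def Y_def)
  qed
qed

section \<open>Comparison of the candidates\<close>

text \<open>
  The difference of the two sides is affine in \<open>b\<close>, so it is enough to check it at \<open>b = 0\<close> and at
  \<open>b = 2 * x\<close>.
\<close>

lemma dR0_le_image_x_minus_y:
  fixes a b x y :: real
  assumes "0 < a" "a \<le> 1" "0 < b" "0 \<le> y" "y \<le> x" "x \<le> a/2" "b \<le> 2*x"
  shows "dR0 a b x y \<le> (a/2 + 1/2 + (x - y))\<^sup>2 + (b + a/2 + 1/2 - (x - y))\<^sup>2"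
proof -
  let ?w = "x - y"
  define f where "f = (\<lambda>b. (1/2 + a - a\<^sup>2/2 + 2 * ?w\<^sup>2 - 4 * y\<^sup>2) + b * (1 - a - 2 * ?w))"
  have sq: "x\<^sup>2 \<le> (a/2)\<^sup>2" "y\<^sup>2 \<le> (a/2)\<^sup>2"
    using assms by (simp_all add: power_mono)
  have aa: "a\<^sup>2 \<le> a" using assms by (simp add: power2_eq_square mult_left_le)
  have sq': "x\<^sup>2 \<le> a\<^sup>2/4" "y\<^sup>2 \<le> a\<^sup>2/4" using sq by (simp_all add: power_divide)
  have "0 \<le> ?w\<^sup>2" by simp
  then have f0: "0 \<le> f 0" unfolding f_def using aa sq'(2) assms(2) by linarith
  have "0 \<le> x * (1 - a)" using assms by simp
  moreover have "f (2*x) = 1/2 + a - a\<^sup>2/2 + 2 * (x * (1 - a)) - 2 * x\<^sup>2 - 2 * y\<^sup>2"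
    by (simp add: f_def power2_eq_square algebra_simps)
  ultimately have f1: "0 \<le> f (2*x)" using aa sq' assms(2) by linarith
  have "2*x * f b = (2*x - b) * f 0 + b * f (2*x)"
    by (simp add: f_def field_simps)
  also have "\<dots> \<ge> 0" using f0 f1 assms by (intro add_nonneg_nonneg mult_nonneg_nonneg) auto
  finally have "0 \<le> f b" using assms by (simp add: zero_le_mult_iff)
  moreover have "(a/2 + 1/2 + ?w)\<^sup>2 + (b + a/2 + 1/2 - ?w)\<^sup>2 - dR0 a b x y = f b"
    by (simp add: f_def dR0_def power2_eq_square field_simps)
  ultimately show ?thesis by linarith
qed

text \<open>
  Write \<open>V w\<close> for the squared distance of the two-sided unfolding with sign choice \<open>w\<close>, so that
  \<open>dR1 = V (x + y)\<close> and \<open>dU1 = V (y - x)\<close>.  Turning a sign the wrong way, or going round a fourth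
  side, only lengthens the segment; the exception is \<open>w = x - y\<close> when \<open>y < x\<close> and \<open>b < 2 * x\<close>, and
  there the path straight over one side is shorter.
\<close>

lemma below_candidates_imp_below_images:
  fixes a b x y :: real
  assumes "0 < a" "a \<le> 1" "0 < b" "0 \<le> x" "x \<le> a/2" "0 \<le> y" "y \<le> 1/2"
    and d: "m\<^sup>2 \<le> dR0 a b x y" "m\<^sup>2 \<le> dR1 a b x y" "m\<^sup>2 \<le> dR2 a b x y"
      "m\<^sup>2 \<le> dU0 a b x y" "m\<^sup>2 \<le> dU1 a b x y" "m\<^sup>2 \<le> dU2 a b x y"
  shows "below_images m (a/2) (1/2) b x y"
proof -
  let ?n = "a/2 + 1/2"
  define V where "V w = (?n + w)\<^sup>2 + (b + a/2 + 1/2 - w)\<^sup>2" for w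
  have Vdiff: "V u - V w = 2 * (u - w) * (u + w - b)" for u w
    by (simp add: V_def power2_eq_square field_simps)
  have R1: "dR1 a b x y = V (x + y)" and U1: "dU1 a b x y = V (y - x)"
    by (simp_all add: dR1_def dU1_def V_def power2_eq_square field_simps)
  have V1: "m\<^sup>2 \<le> V (x + y)" "m\<^sup>2 \<le> V (y - x)" using d R1 U1 by simp_all
  have V2: "m\<^sup>2 \<le> V (- x - y)"
  proof -
    have "V (- x - y) - V (x + y) = 4 * ((x + y) * b)"
      unfolding Vdiff by (simp add: algebra_simps)
    also have "\<dots> \<ge> 0" using assms by simp
    finally show ?thesis using V1 by simp
  qed
  have V3: "m\<^sup>2 \<le> V (x - y)"
  proof -
    consider "x \<le> y" | "y \<le> x" "2*x \<le> b" | "y \<le> x" "b \<le> 2*x" by linarith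
    then show ?thesis
    proof cases
      case 1
      have "V (x - y) - V (y - x) = 4 * ((y - x) * b)" unfolding Vdiff by (simp add: algebra_simps)
      also have "\<dots> \<ge> 0" using 1 assms by simp
      finally show ?thesis using V1 by simp
    next
      case 2
      have "V (x - y) - V (x + y) = 4 * (y * (b - 2*x))" unfolding Vdiff by (simp add: algebra_simps)
      also have "\<dots> \<ge> 0" using 2 assms by simp
      finally show ?thesis using V1 by simp
    next
      case 3
      then show ?thesis
        using dR0_le_image_x_minus_y[of a b y x] assms d(1) by (simp add: V_def)
    qed
  qed
  have W: "V w \<le> (3*?n - w)\<^sup>2 + (b + a/2 + 1/2 - w)\<^sup>2" if "\<bar>w\<bar> \<le> ?n" for w
  proof -
    have "?n + w \<le> 3*?n - w" "0 \<le> ?n + w" using abs_le_D1[OF that] abs_le_D2[OF that] by auto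
    then show ?thesis unfolding V_def by (intro add_right_mono power_mono) auto
  qed
  have two: "m\<^sup>2 \<le> V w \<and> m\<^sup>2 \<le> (3*?n - w)\<^sup>2 + (b + a/2 + 1/2 - w)\<^sup>2"
    if "w \<in> {x + y, x - y, y - x, - x - y}" for w
  proof -
    have "m\<^sup>2 \<le> V w" using that V1 V2 V3 by blast
    moreover have "\<bar>w\<bar> \<le> ?n" using that assms(1-7) by (auto simp: abs_le_iff)
    ultimately show ?thesis using W[of w] by linarith
  qed
  have three: "(b + 2*c - 2*u)\<^sup>2 \<le> (b + 2*c - 2 * (- u))\<^sup>2" if "0 \<le> u" "u \<le> c" for c u
    using that assms by (intro power_mono) auto
  have R2: "dR2 a b x y = (2*?n)\<^sup>2 + (b + 2*(a/2) - 2*x)\<^sup>2"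
    and U2: "dU2 a b x y = (2*?n)\<^sup>2 + (b + 2*(1/2) - 2*y)\<^sup>2"
    by (simp_all add: dR2_def dU2_def power2_eq_square field_simps)
  have R0: "dR0 a b x y = (2*y)\<^sup>2 + (2*(a/2) + b)\<^sup>2"
    and U0: "dU0 a b x y = (2*x)\<^sup>2 + (2*(1/2) + b)\<^sup>2"
    by (simp_all add: dR0_def dU0_def power2_eq_square field_simps)
  have "m\<^sup>2 \<le> (2*?n)\<^sup>2 + (b + 2*(a/2) - 2*u)\<^sup>2" if "u \<in> {x, - x}" for u
  proof -
    have "m\<^sup>2 \<le> (2*?n)\<^sup>2 + (b + 2*(a/2) - 2*x)\<^sup>2" using d(3) unfolding R2 .
    moreover have "u = x \<or> u = - x" using that by blast
    ultimately show ?thesis using three[OF assms(4,5)] by auto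
  qed
  moreover have "m\<^sup>2 \<le> (2*?n)\<^sup>2 + (b + 2*(1/2) - 2 * v)\<^sup>2" if "v \<in> {y, - y}" for v
  proof -
    have "m\<^sup>2 \<le> (2*?n)\<^sup>2 + (b + 2*(1/2) - 2*y)\<^sup>2" using d(6) unfolding U2 .
    moreover have "v = y \<or> v = - y" using that by blast
    ultimately show ?thesis using three[OF assms(6,7)] by auto
  qed
  ultimately show ?thesis
    using two d(1)[unfolded R0] d(4)[unfolded U0] unfolding below_images_def V_def by blast
qed

lemma candidates_reached:
  fixes a b x y :: real
  assumes "0 < a" "0 < b" "0 \<le> x" "x \<le> a/2" "0 \<le> y" "y \<le> 1/2"
    and d: "d \<in> {dR0 a b x y, dR1 a b x y, dR2 a b x y, dU0 a b x y, dU1 a b x y, dU2 a b x y}"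
  shows "\<exists>l. reach (shell (a/2) (1/2) b) (x, y, b) (- x, - y, 0) l \<and> l\<^sup>2 \<le> d"
proof -
  let ?S = "shell (a/2) (1/2) b"
  have pos: "0 < a/2" "0 < (1/2::real)" "0 < b" and ax: "\<bar>x\<bar> \<le> a/2" and ay: "\<bar>y\<bar> \<le> 1/2"
    using assms by auto
  have swap: "\<exists>l. reach ?S (x, y, b) (- x, - y, 0) l \<and> l\<^sup>2 \<le> e"
    if "\<exists>l. reach (shell (1/2) (a/2) b) (y, x, b) (- y, - x, 0) l \<and> l\<^sup>2 \<le> e" for e
    using that reach_image[of swap_xy, OF dist_swap_xy, of "shell (1/2) (a/2) b" "(y, x, b)" "(- y, - x, 0)"]
    by (auto simp: shell_swap_xy)
  from d consider "d = dR0 a b x y" | "d = dR1 a b x y" | "d = dR2 a b x y"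
    | "d = dU0 a b x y" | "d = dU1 a b x y" | "d = dU2 a b x y" by blast
  then show ?thesis
  proof cases
    case 1
    have "d = (2*y)\<^sup>2 + (2*(a/2) + b)\<^sup>2"
      by (simp add: 1 dR0_def power2_eq_square field_simps)
    then show ?thesis using straight_over_side_x[OF pos ax ay] by auto
  next
    case 2
    have "d = (a/2 + 1/2 + x + y)\<^sup>2 + (b + a/2 + 1/2 - x - y)\<^sup>2"
      by (simp add: 2 dR1_def power2_eq_square field_simps)
    then show ?thesis using over_two_sides_flip[OF pos assms(3,4) ay] by simp
  next
    case 3
    have "d = (2*(a/2 + 1/2))\<^sup>2 + (b + 2*(a/2) - 2*x)\<^sup>2"
      by (simp add: 3 dR2_def power2_eq_square field_simps)
    then show ?thesis using over_three_sides[OF pos assms(3-6)] by simp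
  next
    case 4
    have "d = (2*x)\<^sup>2 + (2*(1/2) + b)\<^sup>2"
      by (simp add: 4 dU0_def power2_eq_square field_simps)
    then show ?thesis using straight_over_side_y[OF pos ax ay] by auto
  next
    case 5
    have "d = (1/2 + a/2 + y - x)\<^sup>2 + (b + 1/2 + a/2 - y + x)\<^sup>2"
      by (simp add: 5 dU1_def power2_eq_square field_simps)
    then show ?thesis using swap over_two_sides[OF pos(2,1,3) assms(5,6) ax] by simp
  next
    case 6
    have "d = (2*(1/2 + a/2))\<^sup>2 + (b + 2*(1/2) - 2*y)\<^sup>2"
      by (simp add: 6 dU2_def power2_eq_square field_simps)
    then show ?thesis using swap over_three_sides[OF pos(2,1,3) assms(5,6,3,4)] by simp
  qed
qed

theorem mainTheorem1:
  fixes a b x y :: real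
  assumes "0 < a" and "a \<le> 1" and "0 < b"
    and "0 \<le> x" and "x \<le> a/2" and "0 \<le> y" and "y \<le> 1/2"
  shows "(\<exists>g \<in> opposite_paths a b x y. path_length g = ennreal (opposite_dist a b x y)) \<and>
    (opposite_dist a b x y)\<^sup>2 =
      Min {dR0 a b x y, dR1 a b x y, dR2 a b x y, dU0 a b x y, dU1 a b x y, dU2 a b x y}"
proof -
  let ?D = "{dR0 a b x y, dR1 a b x y, dR2 a b x y, dU0 a b x y, dU1 a b x y, dU2 a b x y}"
  let ?S = "shell (a/2) (1/2) b"
  have paths: "opposite_paths a b x y = paths_within ?S (x, y, b) (- x, - y, 0)"
    using assms by (simp add: opposite_paths_def box_surface_eq)
  have "Min ?D \<in> ?D" by (rule Min_in) auto
  then obtain l where l: "reach ?S (x, y, b) (- x, - y, 0) l" "l\<^sup>2 \<le> Min ?D"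
    using candidates_reached assms by blast
  then have l0: "0 \<le> l" by (simp add: reach_def)
  define m where "m = sqrt (Min ?D)"
  have "0 \<le> Min ?D" using l(2) zero_le_power2[of l] by linarith
  then have m: "m\<^sup>2 = Min ?D" "0 \<le> m" by (simp_all add: m_def)
  have "m\<^sup>2 \<le> d" if "d \<in> ?D" for d
    unfolding m using that by (intro Min_le) auto
  then have "below_images m (a/2) (1/2) b x y"
    using assms by (intro below_candidates_imp_below_images) auto
  then have lower: "ennreal m \<le> path_length g" if "g \<in> opposite_paths a b x y" for g
    using that assms unfolding paths by (intro path_length_ge) auto
  obtain g where g: "g \<in> opposite_paths a b x y" "path_length g \<le> ennreal l"
    using reach_path[OF l(1)] unfolding paths by blast
  have "l \<le> m" unfolding m_def using l(2) by (rule real_le_rsqrt)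
  then have "path_length g \<le> ennreal m" using g(2) by (auto intro: order_trans ennreal_leI)
  then have len: "path_length g = ennreal m" using lower[OF g(1)] by (rule antisym)
  have "intrinsic_dist (box_surface a b) (x, y, b) (- x, - y, 0) = ennreal m"
    unfolding intrinsic_dist_def opposite_paths_def[symmetric]
    by (rule antisym) (use lower g(1) len in \<open>auto intro: INF_lower2 INF_greatest\<close>)
  then have D: "opposite_dist a b x y = m" using m(2) by (simp add: opposite_dist_def)
  show ?thesis unfolding D using g(1) len m(1) by blast
qed

end
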